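(* Let $\Gamma$ be an additive subgroup of $\mathbb{R}$, let $E$ be a finite set, and let $\mathsf{M}=(E,\nu_{\mathsf{M}})$ be a valuated matroid of rank $r$ on $E$ with values in $\overline{\Gamma}$. Let $\widetilde{\nu}_{\mathsf{M}}\colon\binom{E}{\leq r}\to\overline{\Gamma}$ be its extension defined by $\widetilde{\nu}_{\mathsf{M}}(S)=\min\{\nu_{\mathsf{M}}(B)\mid B\in\binom{E}{r},\ S\subseteq B\}$. Fix $0<q\leq 1$ and set $$I_k(\mathsf{M}):=\sum_{S\in\binom{E}{k}} q^{\widetilde{\nu}_{\mathsf{M}}(S)}\qquad (0\leq k\leq r),$$ with the convention $q^{\infty}=0$. Then for all $1\leq k<r$, $$I_k(\mathsf{M})^2\ \geq\ \frac{k+1}{k}\, I_{k+1}(\mathsf{M})\, I_{k-1}(\mathsf{M}).$$ In particular the sequence $(I_k(\mathsf{M}))_{k}$ is log-concave.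
   Context: $\overline{\Gamma}=\Gamma\sqcup\{\infty\}$ with $\infty$ larger than every element of $\Gamma$. For a finite set $E$ and an integer $r\ge 0$, $\binom{E}{r}$ (resp. $\binom{E}{\leq r}$) denotes the set of subsets of $E$ with exactly $r$ (resp. at most $r$) elements. A valuated matroid $\mathsf{M}$ of rank $r$ on $E$ is a map $\nu_{\mathsf{M}}\colon\binom{E}{r}\to\overline{\Gamma}$, not identically $\infty$, such that for all $S,T\in\binom{E}{r}$ and every $s\in S- T$ there exists $t\in T- S$ with $\nu_{\mathsf{M}}(S)+\nu_{\mathsf{M}}(T)\geq \nu_{\mathsf{M}}(S-\{s\}\cup\{t\})+\nu_{\mathsf{M}}(T-\{t\}\cup\{s\})$. *)

theory Defs
  imports "HOL-Analysis.Analysis"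
begin

definition additive_subgroup_real :: "real set \<Rightarrow> bool" where
  "additive_subgroup_real G \<longleftrightarrow> 0 \<in> G \<and> (\<forall>x\<in>G. \<forall>y\<in>G. x - y \<in> G)"

definition valued_in_Gamma_bar :: "real set \<Rightarrow> ereal \<Rightarrow> bool" where
  "valued_in_Gamma_bar G v \<longleftrightarrow> v = \<infinity> \<or> (\<exists>x\<in>G. v = ereal x)"

definition subsets_card :: "'a set \<Rightarrow> nat \<Rightarrow> 'a set set" where
  "subsets_card E r = {S. S \<subseteq> E \<and> card S = r}"

definition valuated_matroid ::
  "real set \<Rightarrow> 'a set \<Rightarrow> nat \<Rightarrow> ('a set \<Rightarrow> ereal) \<Rightarrow> bool" where
  "valuated_matroid G E r \<nu> \<longleftrightarrow>
     finite E \<and>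
     (\<forall>S\<in>subsets_card E r. valued_in_Gamma_bar G (\<nu> S)) \<and>
     (\<exists>S\<in>subsets_card E r. \<nu> S \<noteq> \<infinity>) \<and>
     (\<forall>S\<in>subsets_card E r. \<forall>T\<in>subsets_card E r. \<forall>s\<in>S - T.
        \<exists>t\<in>T - S. \<nu> S + \<nu> T \<ge> \<nu> (S - {s} \<union> {t}) + \<nu> (T - {t} \<union> {s}))"

definition nu_ext :: "'a set \<Rightarrow> nat \<Rightarrow> ('a set \<Rightarrow> ereal) \<Rightarrow> 'a set \<Rightarrow> ereal" where
  "nu_ext E r \<nu> S = Min (\<nu> ` {B \<in> subsets_card E r. S \<subseteq> B})"

definition qpow :: "real \<Rightarrow> ereal \<Rightarrow> real" where
  "qpow q v = (if v = \<infinity> then 0 else q powr (real_of_ereal v))"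

definition I_k :: "real \<Rightarrow> 'a set \<Rightarrow> nat \<Rightarrow> ('a set \<Rightarrow> ereal) \<Rightarrow> nat \<Rightarrow> real" where
  "I_k q E r \<nu> k = (\<Sum>S\<in>subsets_card E k. qpow q (nu_ext E r \<nu> S))"

end

(* Let w S be the maximum of q^nu over the bases containing S. Homogenise the generating function of
   w by an extra variable None of weight t > 0, so that contractions of the resulting form are indexed
   by multisets over E together with None, and extsum p V d m is d! times the degree d part after
   contracting m. Its Hessians have at most one positive eigenvalue: for d = 0 a Schur complement
   with respect to None is an ultrametric kernel by the valuated exchange axiom, and the inductive
   step is a Bochner-type argument, where row None connects all nonzero rows. The reversed
   Cauchy-Schwarz inequality for the constant vector and the unit vector at None, in the limit
   t -> 0, is log-concavity of k! I_k. *)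
theory Submission
  imports Defs "HOL-Library.Multiset"
begin

text \<open>Log-concavity compares three degrees, whereas a Hessian has only one; padding by
  \<open>None\<close> brings all three numbers into one quadratic form. The weight t has to be
  positive: at t = 0 the row of \<open>None\<close> vanishes, so the pivot of the Schur complement
  is 0 and the other rows are no longer connected. Only the all-ones vector is tested against,
  because it turns the Hessian contracted at l into row l of the next Hessian, and this lets the
  induction close. The constant (k+1)/k is (k+1)! (k-1)! / k!^2, which stems from summing over
  ordered words.\<close>

section \<open>Bilinear forms and the reversed Cauchy-Schwarz inequality\<close>

definition bform :: "'v set \<Rightarrow> ('v \<Rightarrow> 'v \<Rightarrow> real) \<Rightarrow> ('v \<Rightarrow> real) \<Rightarrow> ('v \<Rightarrow> real) \<Rightarrow> real" where
  "bform V H u v = (\<Sum>i\<in>V. u i * (\<Sum>j\<in>V. H i j * v j))"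

text \<open>For a symmetric \<open>H\<close> on a finite \<open>V\<close> with positive total sum
  this says that \<open>H\<close> has exactly one positive eigenvalue. A nonnegative
  \<open>H\<close> with total sum 0 is the zero form, so nothing is lost there.\<close>

definition hyperbolic :: "'v set \<Rightarrow> ('v \<Rightarrow> 'v \<Rightarrow> real) \<Rightarrow> bool" where
  "hyperbolic V H \<longleftrightarrow>
     (\<forall>v. bform V H (\<lambda>_. 1) (\<lambda>_. 1) * bform V H v v \<le> (bform V H (\<lambda>_. 1) v)\<^sup>2)"

lemma bform_sym:
  assumes "\<And>i j. i \<in> V \<Longrightarrow> j \<in> V \<Longrightarrow> H i j = H j i"
  shows "bform V H u v = bform V H v u"
proof -
  have "bform V H u v = (\<Sum>i\<in>V. \<Sum>j\<in>V. u i * H i j * v j)"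
    by (simp add: bform_def sum_distrib_left mult.assoc)
  also have "\<dots> = (\<Sum>j\<in>V. \<Sum>i\<in>V. u i * H i j * v j)"
    by (rule sum.swap)
  also have "\<dots> = (\<Sum>j\<in>V. \<Sum>i\<in>V. v j * (H j i * u i))"
    by (intro sum.cong refl) (simp add: assms)
  finally show ?thesis by (simp add: bform_def sum_distrib_left)
qed

lemma bform_lincomb_right:
  "bform V H u (\<lambda>i. a * v i + b * w i) = a * bform V H u v + b * bform V H u w"
  by (simp add: bform_def sum.distrib sum_distrib_left distrib_left algebra_simps)

lemma bform_lincomb_left:
  "bform V H (\<lambda>i. a * v i + b * w i) u = a * bform V H v u + b * bform V H w u"
  by (simp add: bform_def sum.distrib sum_distrib_left distrib_left algebra_simps)

lemma bform_lincomb_sq: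
  assumes "\<And>i j. i \<in> V \<Longrightarrow> j \<in> V \<Longrightarrow> H i j = H j i"
  shows "bform V H (\<lambda>i. a * u i + b * v i) (\<lambda>i. a * u i + b * v i)
       = a\<^sup>2 * bform V H u u + 2 * a * b * bform V H u v + b\<^sup>2 * bform V H v v"
  unfolding bform_lincomb_left bform_lincomb_right
  using bform_sym[of V H v u, OF assms] by (simp add: power2_eq_square algebra_simps)

text \<open>Dirichlet energy of the graph with edge weights \<open>H\<close> and the row sums as
  degrees. For nonnegative \<open>H\<close> it bounds the form by the degree form, with equality
  only for v constant along edges.\<close>

lemma bform_laplacian:
  assumes sym: "\<And>i j. i \<in> V \<Longrightarrow> j \<in> V \<Longrightarrow> H i j = H j i"
  shows "(\<Sum>i\<in>V. \<Sum>j\<in>V. H i j * (v i - v j)\<^sup>2)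
       = 2 * ((\<Sum>i\<in>V. (\<Sum>j\<in>V. H i j) * (v i)\<^sup>2) - bform V H v v)"
proof -
  have "(\<Sum>i\<in>V. \<Sum>j\<in>V. H i j * (v j)\<^sup>2) = (\<Sum>j\<in>V. \<Sum>i\<in>V. H i j * (v j)\<^sup>2)"
    by (rule sum.swap)
  also have "\<dots> = (\<Sum>i\<in>V. \<Sum>j\<in>V. H i j * (v i)\<^sup>2)"
    by (intro sum.cong refl) (simp add: sym)
  finally have *: "(\<Sum>i\<in>V. \<Sum>j\<in>V. H i j * (v j)\<^sup>2) = (\<Sum>i\<in>V. \<Sum>j\<in>V. H i j * (v i)\<^sup>2)" .
  have "(\<Sum>i\<in>V. \<Sum>j\<in>V. H i j * (v i - v j)\<^sup>2)
      = (\<Sum>i\<in>V. \<Sum>j\<in>V. H i j * (v i)\<^sup>2) + (\<Sum>i\<in>V. \<Sum>j\<in>V. H i j * (v j)\<^sup>2)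
        - 2 * (\<Sum>i\<in>V. \<Sum>j\<in>V. v i * (H i j * v j))"
    unfolding sum_distrib_left sum.distrib[symmetric] sum_subtractf[symmetric]
    by (intro sum.cong refl) (simp add: power2_eq_square algebra_simps)
  then show ?thesis
    unfolding * by (simp add: bform_def sum_distrib_left sum_distrib_right)
qed

section \<open>From a Bochner inequality to hyperbolicity\<close>

text \<open>For b nonzero, s = -b / (|c| + 1) lets the linear term win. This serves as the
  first-order condition at a maximum.\<close>

lemma linear_coeff_zero:
  fixes b c :: real
  assumes "\<And>s. 0 \<le> 2 * s * b + s\<^sup>2 * c"
  shows "b = 0"
proof (rule ccontr)
  assume "b \<noteq> 0"
  define n where "n = \<bar>c\<bar> + 1"
  have n: "n > 0" "c \<le> n" by (auto simp: n_def)
  have "0 \<le> 2 * (- b / n) * b + (- b / n)\<^sup>2 * c" by (rule assms)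
  also have "\<dots> = (b / n)\<^sup>2 * (c - 2 * n)"
    using n by (simp add: field_simps power2_eq_square)
  also have "\<dots> < 0"
    using n \<open>b \<noteq> 0\<close> by (intro mult_pos_neg) auto
  finally show False by simp
qed

text \<open>Vectors are functions on the whole, possibly infinite, type, so the compactness behind
  the extremal argument is Tychonoff's.\<close>

lemma compact_function_box:
  fixes a b :: "'v \<Rightarrow> real"
  shows "compact {v. \<forall>i. v i \<in> {a i..b i}}"
proof -
  have "compactin (product_topology (\<lambda>i::'v. euclidean::real topology) UNIV)
          (PiE UNIV (\<lambda>i. {a i..b i}))"
    by (subst compactin_PiE) auto
  moreover have "PiE UNIV (\<lambda>i. {a i..b i}) = {v. \<forall>i. v i \<in> {a i..b i}}"
    by (auto simp: PiE_UNIV_domain)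
  ultimately show ?thesis
    by (metis compactin_euclidean_iff euclidean_product_topology)
qed

text \<open>A form violating the conclusion has, relative to the diagonal form \<^term>\<open>D\<close> of row sums, a
  positive eigenvalue \<^term>\<open>l\<close> on the complement of the constant vector. The hypothesis forces
  \<open>l \<le> l\<^sup>2\<close>, while the Laplacian identity and the star around \<^term>\<open>z\<close> force \<open>l < 1\<close>.\<close>

lemma hyperbolic_if_bochner_pos:
  fixes H :: "'v \<Rightarrow> 'v \<Rightarrow> real"
  assumes fin: "finite V" and z: "z \<in> V"
    and sym: "\<And>i j. i \<in> V \<Longrightarrow> j \<in> V \<Longrightarrow> H i j = H j i"
    and nonneg: "\<And>i j. i \<in> V \<Longrightarrow> j \<in> V \<Longrightarrow> 0 \<le> H i j"
    and star: "\<And>i. i \<in> V \<Longrightarrow> 0 < H i z"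
    and D_def: "D = (\<lambda>i. \<Sum>j\<in>V. H i j)"
    and bochner: "\<And>v. bform V H v v \<le> (\<Sum>i\<in>V. (\<Sum>j\<in>V. H i j * v j)\<^sup>2 / D i)"
  shows "hyperbolic V H"
proof -
  define T where "T = (\<Sum>i\<in>V. D i)"
  have Dpos: "0 < D i" if "i \<in> V" for i
    unfolding D_def using that fin z nonneg star by (intro sum_pos2[of V z]) auto
  have Tpos: "0 < T"
    unfolding T_def using Dpos fin z by (intro sum_pos) auto
  have one_right: "bform V H v (\<lambda>_. 1) = (\<Sum>i\<in>V. D i * v i)" for v
    by (simp add: bform_def D_def mult.commute)
  have one_left: "bform V H (\<lambda>_. 1) v = (\<Sum>i\<in>V. D i * v i)" for v
    using one_right bform_sym[of V H, OF sym] by simp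
  have form_sq: "bform V H (\<lambda>i. a * u i + b * v i) (\<lambda>i. a * u i + b * v i)
       = a\<^sup>2 * bform V H u u + 2 * a * b * bform V H u v + b\<^sup>2 * bform V H v v" for a b u v
    using sym by (rule bform_lincomb_sq)
  define N where "N = (\<lambda>v. \<Sum>i\<in>V. D i * (v i)\<^sup>2)"
  have N_sq: "N (\<lambda>i. a * u i + b * v i)
      = a\<^sup>2 * N u + 2 * a * b * (\<Sum>i\<in>V. D i * u i * v i) + b\<^sup>2 * N v" for a b u v
    unfolding N_def sum_distrib_left sum.distrib[symmetric]
    by (intro sum.cong refl) (simp add: power2_eq_square algebra_simps)
  have N_pos: "0 < N v" if "i \<in> V" "v i \<noteq> 0" for i v
    unfolding N_def using that fin Dpos
    by (intro sum_pos2[of V i]) (auto simp: less_imp_le)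
  \<comment> \<open>\<open>D\<close> is \<open>H\<close> applied to the all-ones vector, so
    \<open>D\<close>-orthogonality to the constants is \<open>H\<close>-orthogonality. Nonpositivity
    on this complement is the whole claim.\<close>
  have neg: "bform V H w w \<le> 0" if w0: "(\<Sum>i\<in>V. D i * w i) = 0" for w
  proof (rule ccontr)
    assume "\<not> bform V H w w \<le> 0"
    then have wpos: "0 < bform V H w w" by simp
    then have "bform V H w w \<noteq> 0" by simp
    then obtain i where "i \<in> V" "w i * (\<Sum>j\<in>V. H i j * w j) \<noteq> 0"
      unfolding bform_def by (rule sum.not_neutral_contains_not_neutral)
    then have "i \<in> V" "w i \<noteq> 0" by auto
    then have Nw: "0 < N w" by (rule N_pos)
    \<comment> \<open>\<open>N v = 1\<close> forces D i * (v i)^2 \<le> 1, hence the radius. Off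
      \<open>V\<close>, where the form does not look, coordinates are pinned to 0.\<close>
    define b where "b = (\<lambda>i. if i \<in> V then 1 / sqrt (D i) else 0)"
    define C where "C = {v. \<forall>i. v i \<in> {- b i..b i}} \<inter>
      ({v. (\<Sum>i\<in>V. D i * v i) = 0} \<inter> {v. N v = 1})"
    have cont: "continuous_on UNIV (\<lambda>v::'v \<Rightarrow> real. v i)" for i
      by simp
    have "compact C"
      unfolding C_def N_def
      by (intro compact_Int_closed compact_function_box closed_Int closed_Collect_eq
          continuous_intros cont)
    have in_C: "\<exists>c>0. (\<lambda>i. c * (if i \<in> V then u i else 0)) \<in> C \<and> c\<^sup>2 * N u = 1"
      if u0: "(\<Sum>i\<in>V. D i * u i) = 0" and Nu: "0 < N u" for u
    proof -
      define c where "c = 1 / sqrt (N u)"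
      define u' where "u' = (\<lambda>i. c * (if i \<in> V then u i else 0))"
      have c: "c > 0" "c\<^sup>2 * N u = 1" using Nu by (auto simp: c_def field_simps)
      have N1: "N u' = 1"
        using c by (simp add: N_def u'_def power_mult_distrib sum_distrib_left algebra_simps)
      have "(\<Sum>i\<in>V. D i * u' i) = c * (\<Sum>i\<in>V. D i * u i)"
        by (simp add: u'_def sum_distrib_left algebra_simps)
      moreover have "u' i \<in> {- b i..b i}" for i
      proof (cases "i \<in> V")
        case True
        have "D i * (u' i)\<^sup>2 \<le> N u'"
          unfolding N_def using True fin Dpos
          by (intro member_le_sum) (auto simp: less_imp_le)
        then have "(u' i)\<^sup>2 \<le> 1 / D i" using N1 Dpos[OF True] by (simp add: field_simps)
        then have "\<bar>u' i\<bar> \<le> sqrt (1 / D i)" by (rule real_le_rsqrt[of "\<bar>u' i\<bar>", simplified])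
        then show ?thesis using True by (auto simp: b_def real_sqrt_divide)
      qed (simp add: u'_def b_def)
      ultimately have "u' \<in> C" using N1 u0 by (simp add: C_def)
      then show ?thesis using c unfolding u'_def by blast
    qed
    have restr: "bform V H (\<lambda>i. c * (if i \<in> V then u i else 0)) (\<lambda>i. c * (if i \<in> V then u i else 0))
        = c\<^sup>2 * bform V H u u" for c u
      by (simp add: bform_def sum_distrib_left power2_eq_square algebra_simps)
    have "C \<noteq> {}" using in_C[OF w0 Nw] by blast
    moreover have "continuous_on C (\<lambda>v. bform V H v v)"
      unfolding bform_def
      by (intro continuous_intros continuous_on_subset[OF cont subset_UNIV])
    ultimately have "\<exists>v\<in>C. \<forall>u\<in>C. bform V H u u \<le> bform V H v v"
      by (rule continuous_attains_sup[OF \<open>compact C\<close>])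
    then obtain v where vC: "v \<in> C"
      and vmax: "\<And>u. u \<in> C \<Longrightarrow> bform V H u u \<le> bform V H v v"
      by blast
    define l where "l = bform V H v v"
    have v0: "(\<Sum>i\<in>V. D i * v i) = 0" and Nv: "N v = 1"
      using vC by (auto simp: C_def)
    have lpos: "0 < l"
    proof -
      obtain c where c: "c > 0" "(\<lambda>i. c * (if i \<in> V then w i else 0)) \<in> C"
        using in_C[OF w0 Nw] by blast
      have "0 < c\<^sup>2 * bform V H w w" using c wpos by simp
      also have "\<dots> \<le> l" using vmax[OF c(2)] by (simp add: restr l_def)
      finally show ?thesis .
    qed
    have rayleigh: "bform V H u u \<le> l * N u" if u0: "(\<Sum>i\<in>V. D i * u i) = 0" for u
    proof (cases "\<exists>i\<in>V. u i \<noteq> 0")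
      case True
      then have Nu: "0 < N u" using N_pos by blast
      obtain c where c: "c > 0" "(\<lambda>i. c * (if i \<in> V then u i else 0)) \<in> C" "c\<^sup>2 * N u = 1"
        using in_C[OF u0 Nu] by blast
      have "c\<^sup>2 * bform V H u u \<le> l * (c\<^sup>2 * N u)"
        using vmax[OF c(2)] c(3) by (simp add: restr l_def)
      then have "c\<^sup>2 * bform V H u u \<le> c\<^sup>2 * (l * N u)" by (simp add: algebra_simps)
      then show ?thesis using c(1) by simp
    qed (simp add: bform_def N_def)
    have crit: "bform V H v u = l * (\<Sum>i\<in>V. D i * v i * u i)"
      if u0: "(\<Sum>i\<in>V. D i * u i) = 0" for u
    proof -
      have "0 \<le> 2 * s * (l * (\<Sum>i\<in>V. D i * v i * u i) - bform V H v u)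
          + s\<^sup>2 * (l * N u - bform V H u u)" for s
      proof -
        have "(\<Sum>i\<in>V. D i * (1 * v i + s * u i)) = 1 * (\<Sum>i\<in>V. D i * v i) + s * (\<Sum>i\<in>V. D i * u i)"
          unfolding sum_distrib_left sum.distrib[symmetric]
          by (intro sum.cong refl) (simp add: algebra_simps)
        then have "bform V H (\<lambda>i. 1 * v i + s * u i) (\<lambda>i. 1 * v i + s * u i)
            \<le> l * N (\<lambda>i. 1 * v i + s * u i)"
          using u0 v0 by (intro rayleigh) simp
        then show ?thesis
          unfolding N_sq form_sq
          using Nv by (simp add: l_def algebra_simps)
      qed
      then have "l * (\<Sum>i\<in>V. D i * v i * u i) - bform V H v u = 0" by (rule linear_coeff_zero)
      then show ?thesis by simp
    qed
    have eigen: "(\<Sum>j\<in>V. H i j * v j) = l * (D i * v i)" if i: "i \<in> V" for i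
    proof -
      define e where "e = (\<lambda>j. if j = i then 1 else (0::real))"
      \<comment> \<open>\<open>crit\<close> only tests vectors \<open>D\<close>-orthogonal to the
        constants, so the unit vector is projected first. The correction drops out again because
        \<open>v\<close> is itself orthogonal to the constants.\<close>
      define u where "u = (\<lambda>j. 1 * e j + (- D i / T) * 1)"
      have De: "(\<Sum>j\<in>V. g j * e j) = g i" for g
        using i fin by (simp add: e_def if_distrib cong: if_cong)
      have "(\<Sum>j\<in>V. D j * u j) = (\<Sum>j\<in>V. D j * e j) - D i / T * (\<Sum>j\<in>V. D j)"
        unfolding u_def sum_distrib_left sum_subtractf[symmetric]
        by (intro sum.cong refl) (simp add: algebra_simps)
      also have "\<dots> = 0" using Tpos by (simp add: De T_def)
      finally have "bform V H v u = l * (\<Sum>j\<in>V. D j * v j * u j)" by (rule crit)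
      moreover have "bform V H v u = (\<Sum>j\<in>V. H i j * v j)"
      proof -
        have "bform V H v u = bform V H v e + (- D i / T) * bform V H v (\<lambda>_. 1)"
          unfolding u_def bform_lincomb_right by simp
        also have "\<dots> = bform V H v e"
          using v0 by (simp add: one_right)
        also have "\<dots> = bform V H e v"
          by (rule bform_sym[OF sym])
        also have "\<dots> = (\<Sum>j\<in>V. H i j * v j)"
          unfolding bform_def by (subst mult.commute) (rule De)
        finally show ?thesis .
      qed
      moreover have "(\<Sum>j\<in>V. D j * v j * u j) = D i * v i"
      proof -
        have "(\<Sum>j\<in>V. D j * v j * u j) = (\<Sum>j\<in>V. D j * v j * e j) - D i / T * (\<Sum>j\<in>V. D j * v j)"
          unfolding u_def sum_distrib_left sum_subtractf[symmetric]
          by (intro sum.cong refl) (simp add: algebra_simps)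
        then show ?thesis using v0 De by simp
      qed
      ultimately show ?thesis by simp
    qed
    have terms: "0 \<le> H i j * (v i - v j)\<^sup>2" if "i \<in> V" "j \<in> V" for i j
      using nonneg that by simp
    have "l \<le> (\<Sum>i\<in>V. (l * (D i * v i))\<^sup>2 / D i)"
      using bochner[of v] by (simp add: l_def[symmetric] eigen)
    also have "\<dots> = l\<^sup>2 * N v"
      unfolding N_def sum_distrib_left using Dpos
      by (intro sum.cong refl) (simp add: power2_eq_square Dpos[THEN less_imp_neq, symmetric])
    finally have "1 \<le> l" using lpos Nv by (simp add: power2_eq_square)
    have lap: "(\<Sum>i\<in>V. \<Sum>j\<in>V. H i j * (v i - v j)\<^sup>2) = 2 * (1 - l)"
      using bform_laplacian[of V H v, OF sym] Nv by (simp add: l_def N_def D_def)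
    have "0 \<le> 2 * (1 - l)"
      unfolding lap[symmetric] by (intro sum_nonneg terms)
    with \<open>1 \<le> l\<close> have "l = 1" by simp
    \<comment> \<open>Zero energy makes \<open>v\<close> constant along edges. Every vertex is
      adjacent to \<open>z\<close>, so \<open>v\<close> is constant, hence 0 by orthogonality,
      against \<open>N v = 1\<close>.\<close>
    with lap have "(\<Sum>i\<in>V. \<Sum>j\<in>V. H i j * (v i - v j)\<^sup>2) = 0" by simp
    then have "\<forall>i\<in>V. (\<Sum>j\<in>V. H i j * (v i - v j)\<^sup>2) = 0"
      using terms by (subst (asm) sum_nonneg_eq_0_iff[OF fin]) (simp_all add: sum_nonneg)
    then have "H i z * (v i - v z)\<^sup>2 = 0" if "i \<in> V" for i
      using that z terms[OF that] sum_nonneg_eq_0_iff[OF fin, of "\<lambda>j. H i j * (v i - v j)\<^sup>2"] by blast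
    then have const: "v i = v z" if "i \<in> V" for i
      using that star by fastforce
    then have "(\<Sum>i\<in>V. D i * v i) = T * v z"
      by (simp add: T_def sum_distrib_right)
    then have "v z = 0" using v0 Tpos by simp
    then have "N v = 0" using const by (simp add: N_def)
    then show False using Nv by simp
  qed
  show ?thesis
    unfolding hyperbolic_def
  proof
    fix v
    \<comment> \<open>\<open>c\<close> is the \<open>D\<close>-weighted mean of v, so v - c falls
      under \<open>neg\<close>.\<close>
    define c where "c = (\<Sum>i\<in>V. D i * v i) / T"
    have cT: "(\<Sum>i\<in>V. D i * v i) = c * T" using Tpos by (simp add: c_def)
    have T1: "bform V H (\<lambda>_. 1) (\<lambda>_. 1) = T" by (simp add: one_left T_def)
    have "(\<Sum>i\<in>V. D i * (1 * v i + (- c) * 1)) = (\<Sum>i\<in>V. D i * v i) - c * T"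
      by (simp add: T_def algebra_simps sum_subtractf sum_distrib_left)
    then have "bform V H (\<lambda>i. 1 * v i + (- c) * 1) (\<lambda>i. 1 * v i + (- c) * 1) \<le> 0"
      using cT by (intro neg) simp
    then have "bform V H v v \<le> c\<^sup>2 * T"
      unfolding form_sq T1 unfolding one_right cT
      by (simp add: power2_eq_square algebra_simps)
    then have "T * bform V H v v \<le> T * (c\<^sup>2 * T)" using Tpos by simp
    then show "bform V H (\<lambda>_. 1) (\<lambda>_. 1) * bform V H v v \<le> (bform V H (\<lambda>_. 1) v)\<^sup>2"
      unfolding T1 one_left cT by (simp add: power2_eq_square algebra_simps)
  qed
qed

text \<open>By \<open>star\<close>, a row vanishing at \<open>z\<close> vanishes altogether.
  Deleting such rows leaves \<open>H i z\<close> strictly positive, and they contribute nothing to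
  \<open>bochner\<close> because 0 / 0 = 0.\<close>

lemma hyperbolic_if_bochner:
  fixes H :: "'v \<Rightarrow> 'v \<Rightarrow> real"
  assumes fin: "finite V" and z: "z \<in> V"
    and sym: "\<And>i j. i \<in> V \<Longrightarrow> j \<in> V \<Longrightarrow> H i j = H j i"
    and nonneg: "\<And>i j. i \<in> V \<Longrightarrow> j \<in> V \<Longrightarrow> 0 \<le> H i j"
    and star: "\<And>i j. i \<in> V \<Longrightarrow> j \<in> V \<Longrightarrow> 0 < H i j \<Longrightarrow> 0 < H i z"
    and bochner: "\<And>v. bform V H v v \<le> (\<Sum>i\<in>V. (\<Sum>j\<in>V. H i j * v j)\<^sup>2 / (\<Sum>j\<in>V. H i j))"
  shows "hyperbolic V H"
proof -
  define V' where "V' = {i \<in> V. 0 < H i z}"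
  have V': "V' \<subseteq> V" "finite V'" using fin by (auto simp: V'_def)
  have zero: "H i j = 0" if "i \<in> V" "j \<in> V" "i \<notin> V' \<or> j \<notin> V'" for i j
    using that nonneg[of i j] star[of i j] star[of j i] sym[of i j] unfolding V'_def by fastforce
  have row: "(\<Sum>j\<in>V'. H i j * v j) = (\<Sum>j\<in>V. H i j * v j)" if "i \<in> V" for i v
    using that zero V' fin by (intro sum.mono_neutral_left) auto
  have row1: "(\<Sum>j\<in>V'. H i j) = (\<Sum>j\<in>V. H i j)" if "i \<in> V" for i
    using row[OF that, of "\<lambda>_. 1"] by simp
  have row0: "(\<Sum>j\<in>V. H i j * v j) = 0" if "i \<in> V - V'" for i v
    using that zero by (intro sum.neutral) auto
  have eq: "bform V' H u v = bform V H u v" for u v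
    unfolding bform_def
    using V' fin row row0 by (intro sum.mono_neutral_cong_left) (auto simp: subset_iff)
  show ?thesis
  proof (cases "z \<in> V'")
    case True
    have "hyperbolic V' H"
    proof (rule hyperbolic_if_bochner_pos[where D = "\<lambda>i. \<Sum>j\<in>V'. H i j", OF V'(2) True])
      fix v
      have "(\<Sum>i\<in>V'. (\<Sum>j\<in>V'. H i j * v j)\<^sup>2 / (\<Sum>j\<in>V'. H i j))
          = (\<Sum>i\<in>V. (\<Sum>j\<in>V. H i j * v j)\<^sup>2 / (\<Sum>j\<in>V. H i j))"
        using V' fin row row1 row0 by (intro sum.mono_neutral_cong_left) (auto simp: subset_iff)
      then show "bform V' H v v \<le> (\<Sum>i\<in>V'. (\<Sum>j\<in>V'. H i j * v j)\<^sup>2 / (\<Sum>j\<in>V'. H i j))"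
        using bochner eq by simp
    qed (use sym nonneg V' in \<open>auto simp: V'_def\<close>)
    then show ?thesis by (simp add: hyperbolic_def eq)
  next
    case False
    \<comment> \<open>A remaining row i has H z i = H i z > 0, and then \<open>star\<close> would
      put \<open>z\<close> itself into \<open>V'\<close>.\<close>
    have "V' = {}"
    proof (rule ccontr)
      assume "V' \<noteq> {}"
      then obtain i where "i \<in> V" "0 < H i z" by (auto simp: V'_def)
      then have "0 < H z z" using star[of z i] sym[of i z] z by simp
      then show False using False z by (simp add: V'_def)
    qed
    then have "bform V H u v = 0" for u v using eq[of u v] by (simp add: bform_def)
    then show ?thesis by (simp add: hyperbolic_def)
  qed
qed

section \<open>Positive semidefinite kernels and the Schur complement\<close>

definition psd :: "'v set \<Rightarrow> ('v \<Rightarrow> 'v \<Rightarrow> real) \<Rightarrow> bool" where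
  "psd V K \<longleftrightarrow> (\<forall>v. 0 \<le> bform V K v v)"

text \<open>Up to reordering, the matrix has one all-ones block per class and zero rows where
  reflexivity fails, so the form is a sum of squared class sums.\<close>

lemma psd_partial_equivalence:
  fixes V :: "'v set"
  assumes fin: "finite V"
    and sym: "\<And>i j. i \<in> V \<Longrightarrow> j \<in> V \<Longrightarrow> R i j \<Longrightarrow> R j i"
    and trans: "\<And>i j l. i \<in> V \<Longrightarrow> j \<in> V \<Longrightarrow> l \<in> V \<Longrightarrow> R i j \<Longrightarrow> R j l \<Longrightarrow> R i l"
  shows "psd V (\<lambda>i j. if R i j then 1 else 0)"
  unfolding psd_def
proof
  fix v :: "'v \<Rightarrow> real"
  define cl where "cl = (\<lambda>i. {j \<in> V. R i j})"
  have cl: "R i j \<longleftrightarrow> cl j = cl i" if "i \<in> V" "j \<in> V" "R i i" for i j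
    using that sym trans unfolding cl_def by blast
  define U where "U = {i \<in> V. R i i}"
  have U: "finite U" "U \<subseteq> V" using fin by (auto simp: U_def)
  have inner: "(\<Sum>j\<in>V. (if R i j then 1 else 0) * v j) = (\<Sum>j | j \<in> U \<and> cl j = cl i. v j)"
    if i: "i \<in> U" for i
  proof -
    have "(\<Sum>j\<in>V. (if R i j then 1 else 0) * v j) = (\<Sum>j\<in>V. if R i j then v j else 0)"
      by (intro sum.cong refl) auto
    also have "\<dots> = (\<Sum>j | j \<in> V \<and> R i j. v j)"
      using fin by (simp add: sum.inter_filter)
    also have "{j. j \<in> V \<and> R i j} = {j. j \<in> U \<and> cl j = cl i}"
      using i sym trans cl unfolding U_def by blast
    finally show ?thesis .
  qed
  have "bform V (\<lambda>i j. if R i j then 1 else 0) v v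
      = (\<Sum>i\<in>U. v i * (\<Sum>j | j \<in> U \<and> cl j = cl i. v j))"
    unfolding bform_def
  proof (rule sum.mono_neutral_cong_right[OF fin U(2)])
    show "\<forall>i\<in>V - U. v i * (\<Sum>j\<in>V. (if R i j then 1 else 0) * v j) = 0"
    proof
      fix i assume "i \<in> V - U"
      then have "\<not> R i j" if "j \<in> V" for j
        using that sym trans unfolding U_def by blast
      then show "v i * (\<Sum>j\<in>V. (if R i j then 1 else 0) * v j) = 0" by simp
    qed
  qed (simp add: inner)
  also have "\<dots> = (\<Sum>c\<in>cl ` U. \<Sum>i | i \<in> U \<and> cl i = c. v i * (\<Sum>j | j \<in> U \<and> cl j = cl i. v j))"
    by (rule sum.image_gen[OF U(1)])
  also have "\<dots> = (\<Sum>c\<in>cl ` U. (\<Sum>i | i \<in> U \<and> cl i = c. v i)\<^sup>2)"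
    by (intro sum.cong refl) (simp add: power2_eq_square sum_distrib_right)
  finally show "0 \<le> bform V (\<lambda>i j. if R i j then 1 else 0) v v"
    by (simp add: sum_nonneg)
qed

text \<open>Peel off the smallest positive value \<^term>\<open>m\<close> of \<^term>\<open>k\<close>: positivity of \<^term>\<open>k\<close> is a partial
  equivalence relation, and the truncation of \<^term>\<open>k\<close> by \<^term>\<open>m\<close> is again ultrametric.\<close>

lemma psd_ultrametric:
  assumes fin: "finite V"
    and "\<And>i j. i \<in> V \<Longrightarrow> j \<in> V \<Longrightarrow> k i j = k j i"
    and "\<And>i j. i \<in> V \<Longrightarrow> j \<in> V \<Longrightarrow> 0 \<le> k i j"
    and "\<And>i j l. i \<in> V \<Longrightarrow> j \<in> V \<Longrightarrow> l \<in> V \<Longrightarrow> min (k i l) (k l j) \<le> k i j"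
  shows "psd V k"
  using assms(2-)
proof (induction "card {x \<in> (\<lambda>(i, j). k i j) ` (V \<times> V). 0 < x}" arbitrary: k rule: less_induct)
  case less
  note sym = less.prems(1) and nonneg = less.prems(2) and ultra = less.prems(3)
  define P where "P = (\<lambda>k::'a \<Rightarrow> 'a \<Rightarrow> real. {x \<in> (\<lambda>(i, j). k i j) ` (V \<times> V). 0 < x})"
  have finP: "finite (P k)" for k using fin by (simp add: P_def)
  have in_P: "k i j \<in> P k" if "i \<in> V" "j \<in> V" "0 < k i j" for k i j
    using that by (force simp: P_def)
  show ?case
  proof (cases "P k = {}")
    case True
    then have "k i j = 0" if "i \<in> V" "j \<in> V" for i j
      using in_P[of i j k] nonneg[of i j] that by fastforce
    then show ?thesis by (simp add: psd_def bform_def)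
  next
    case False
    define m where "m = Min (P k)"
    have mP: "m \<in> P k" using False finP by (simp add: m_def)
    then have m: "0 < m" by (simp add: P_def)
    have m_le: "m \<le> k i j" if "i \<in> V" "j \<in> V" "0 < k i j" for i j
      using in_P[of i j k] that finP by (simp add: m_def)
    define k' where "k' = (\<lambda>i j. max 0 (k i j - m))"
    \<comment> \<open>Truncation shifts positive values down by \<open>m\<close> and sends
      \<open>m\<close> itself to 0, so the number of positive values drops.\<close>
    have "P k' \<subseteq> (\<lambda>x. x - m) ` (P k - {m})"
      using m by (force simp: P_def k'_def max_def split: if_splits)
    then have "card (P k') \<le> card (P k - {m})"
      by (rule surj_card_le[rotated]) (simp add: finP)
    also have "\<dots> < card (P k)"
      using mP finP by (intro psubset_card_mono) auto
    finally have "psd V k'"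
    proof (intro less.hyps)
      fix i j l assume "i \<in> V" "j \<in> V" "l \<in> V"
      then show "min (k' i l) (k' l j) \<le> k' i j"
        using ultra[of i j l] by (auto simp: k'_def)
    qed (auto simp: P_def k'_def sym)
    moreover have "psd V (\<lambda>i j. if 0 < k i j then 1 else 0)"
      using fin
    proof (rule psd_partial_equivalence)
      fix i j l assume "i \<in> V" "j \<in> V" "l \<in> V" "0 < k i j" "0 < k j l"
      then show "0 < k i l" using ultra[of i l j] by auto
    qed (use sym in auto)
    moreover have "bform V k v v
        = m * bform V (\<lambda>i j. if 0 < k i j then 1 else 0) v v + bform V k' v v" for v
      unfolding bform_def sum_distrib_left sum.distrib[symmetric]
    proof (intro sum.cong refl)
      fix i j assume "i \<in> V" "j \<in> V"
      then have "k i j = m * (if 0 < k i j then 1 else 0) + k' i j"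
        using m_le[of i j] nonneg[of i j] m by (auto simp: k'_def)
      then show "v i * (k i j * v j)
          = m * (v i * ((if 0 < k i j then 1 else 0) * v j)) + v i * (k' i j * v j)"
        by (metis (no_types, opaque_lifting) distrib_left distrib_right mult.assoc mult.left_commute)
    qed
    ultimately show ?thesis using m by (simp add: psd_def)
  qed
qed

lemma psd_congruence:
  assumes "psd V k" shows "psd V (\<lambda>i j. h i * h j * k i j)"
proof -
  have "bform V (\<lambda>i j. h i * h j * k i j) v v = bform V k (\<lambda>i. h i * v i) (\<lambda>i. h i * v i)" for v
    by (simp add: bform_def sum_distrib_left algebra_simps)
  then show ?thesis using assms by (simp add: psd_def)
qed

text \<open>The hypothesis bounds c H by the rank-one form of \<open>h\<close>, so \<open>H\<close>
  is nonpositive on the hyperplane orthogonal to \<open>h\<close>. That leaves room for at most one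
  positive direction.\<close>

lemma hyperbolic_if_schur_psd:
  fixes H :: "'v \<Rightarrow> 'v \<Rightarrow> real"
  assumes sym: "\<And>i j. i \<in> V \<Longrightarrow> j \<in> V \<Longrightarrow> H i j = H j i"
    and nonneg: "\<And>i j. i \<in> V \<Longrightarrow> j \<in> V \<Longrightarrow> 0 \<le> H i j"
    and c: "0 < c"
    and psd: "psd V (\<lambda>i j. h i * h j - c * H i j)"
  shows "hyperbolic V H"
  unfolding hyperbolic_def
proof
  fix v
  define L where "L = (\<lambda>u. \<Sum>i\<in>V. h i * u i)"
  have schur: "c * bform V H u u \<le> (L u)\<^sup>2" for u
  proof -
    have "(L u)\<^sup>2 = (\<Sum>i\<in>V. \<Sum>j\<in>V. h i * u i * (h j * u j))"
      by (simp add: L_def power2_eq_square sum_product)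
    moreover have "c * bform V H u u = (\<Sum>i\<in>V. \<Sum>j\<in>V. c * (u i * (H i j * u j)))"
      by (simp add: bform_def sum_distrib_left)
    ultimately have "(L u)\<^sup>2 - c * bform V H u u
        = (\<Sum>i\<in>V. \<Sum>j\<in>V. h i * u i * (h j * u j) - c * (u i * (H i j * u j)))"
      by (simp add: sum_subtractf)
    also have "\<dots> = bform V (\<lambda>i j. h i * h j - c * H i j) u u"
      unfolding bform_def sum_distrib_left by (intro sum.cong refl) (simp add: algebra_simps)
    finally have "bform V (\<lambda>i j. h i * h j - c * H i j) u u = (L u)\<^sup>2 - c * bform V H u u" ..
    moreover have "0 \<le> bform V (\<lambda>i j. h i * h j - c * H i j) u u"
      using psd by (simp add: psd_def)
    ultimately show ?thesis by simp
  qed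
  define a b e where "a = bform V H (\<lambda>_. 1) (\<lambda>_. 1)" and "b = bform V H (\<lambda>_. 1) v"
    and "e = bform V H v v"
  have "0 \<le> a" unfolding a_def bform_def by (simp add: sum_nonneg nonneg)
  have "a * e \<le> b\<^sup>2"
  proof (cases "0 < e")
    case False
    then have "a * e \<le> 0" using \<open>0 \<le> a\<close> by (simp add: mult_nonneg_nonpos)
    then show ?thesis by (meson order_trans zero_le_power2)
  next
    case True
    then have "0 < (L v)\<^sup>2" using schur[of v] c unfolding e_def
      by (meson mult_pos_pos order_less_le_trans)
    define p q where "p = L v" and "q = L (\<lambda>_. 1)"
    \<comment> \<open>The coefficients are chosen so that this combination of the two vectors lies
      in the kernel of \<open>L\<close>.\<close>
    have "L (\<lambda>i. p * 1 + (- q) * v i) = p * L (\<lambda>_. 1) - q * L v"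
      unfolding L_def sum_distrib_left sum_subtractf[symmetric]
      by (intro sum.cong refl) (simp add: algebra_simps)
    then have "c * bform V H (\<lambda>i. p * 1 + (- q) * v i) (\<lambda>i. p * 1 + (- q) * v i) \<le> 0"
      using schur[of "\<lambda>i. p * 1 + (- q) * v i"] by (simp add: p_def q_def)
    moreover have "bform V H (\<lambda>i. p * 1 + (- q) * v i) (\<lambda>i. p * 1 + (- q) * v i)
        = p\<^sup>2 * a + 2 * p * (- q) * b + (- q)\<^sup>2 * e"
      unfolding a_def b_def e_def using sym by (rule bform_lincomb_sq)
    ultimately have "p\<^sup>2 * a - 2 * p * q * b + q\<^sup>2 * e \<le> 0"
      using c by (simp add: mult_le_0_iff)
    \<comment> \<open>Multiplying by e > 0 allows completing the square, which isolates b^2 - a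
      e.\<close>
    then have "e * (p\<^sup>2 * a - 2 * p * q * b + q\<^sup>2 * e) \<le> 0"
      using True by (simp add: mult_le_0_iff)
    moreover have "e * (p\<^sup>2 * a - 2 * p * q * b + q\<^sup>2 * e)
        = (q * e - p * b)\<^sup>2 - p\<^sup>2 * (b\<^sup>2 - a * e)"
      by (simp add: power2_eq_square algebra_simps)
    ultimately have "0 \<le> p\<^sup>2 * (b\<^sup>2 - a * e)"
      using zero_le_power2[of "q * e - p * b"] by linarith
    then show ?thesis using \<open>0 < (L v)\<^sup>2\<close> by (simp add: p_def[symmetric] zero_le_mult_iff)
  qed
  then show "bform V H (\<lambda>_. 1) (\<lambda>_. 1) * bform V H v v \<le> (bform V H (\<lambda>_. 1) v)\<^sup>2"
    by (simp add: a_def b_def e_def)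
qed

text \<open>Normalised by the column of \<open>z\<close>, the entries m i j = H z z * H i j / (h i *
  h j) satisfy m i j \<le> max (m i l) (m l j). So 1 - m is an ultrametric kernel, and rescaling it
  by \<open>h\<close> gives the Schur complement with pivot \<open>H z z\<close>.\<close>

lemma hyperbolic_if_three_term:
  fixes H :: "'v \<Rightarrow> 'v \<Rightarrow> real"
  assumes fin: "finite V" and z: "z \<in> V"
    and sym: "\<And>i j. i \<in> V \<Longrightarrow> j \<in> V \<Longrightarrow> H i j = H j i"
    and nonneg: "\<And>i j. i \<in> V \<Longrightarrow> j \<in> V \<Longrightarrow> 0 \<le> H i j"
    and zz: "0 < H z z"
    and three: "\<And>i j l. i \<in> V \<Longrightarrow> j \<in> V \<Longrightarrow> l \<in> V \<Longrightarrow>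
      H i j * H l z \<le> max (H i l * H j z) (H j l * H i z)"
  shows "hyperbolic V H"
proof (rule hyperbolic_if_schur_psd[OF sym nonneg zz])
  define h where "h = (\<lambda>i. H i z)"
  have h: "0 \<le> h i" if "i \<in> V" for i using nonneg z that by (simp add: h_def)
  \<comment> \<open>For l = \<open>z\<close> both arguments of the maximum agree; this gives m \<le>
    1, so the kernel is nonnegative.\<close>
  have sub: "H z z * H i j \<le> h i * h j" if "i \<in> V" "j \<in> V" for i j
    using three[OF that z] by (simp add: h_def mult.commute)
  have H0: "H i j = 0" if "i \<in> V" "j \<in> V" "h i = 0 \<or> h j = 0" for i j
  proof -
    have "H z z * H i j \<le> 0" using sub[OF that(1,2)] that(3) by auto
    then show ?thesis using zz nonneg[OF that(1,2)] by (simp add: mult_le_0_iff)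
  qed
  define m where "m = (\<lambda>i j. H z z * H i j / (h i * h j))"
  \<comment> \<open>Where \<open>h\<close> vanishes, 0 is the right value: by \<open>H0\<close> the
    Schur complement entry is 0 there too.\<close>
  define k where "k = (\<lambda>i j. if 0 < h i \<and> 0 < h j then 1 - m i j else 0)"
  have k0: "0 \<le> k i j" if "i \<in> V" "j \<in> V" for i j
    using sub[OF that] by (auto simp: k_def m_def)
  have "psd V k"
    using fin
  proof (rule psd_ultrametric)
    fix i j l assume V: "i \<in> V" "j \<in> V" "l \<in> V"
    show "min (k i l) (k l j) \<le> k i j"
    proof (cases "0 < h i \<and> 0 < h j \<and> 0 < h l")
      case True
      define d where "d = H z z / (h i * h j * h l)"
      have "0 \<le> d" using True zz by (simp add: d_def)
      have "m i j = d * (H i j * h l)" "m i l = d * (H i l * h j)" "m l j = d * (H j l * h i)"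
        using True sym[of l j] V by (simp_all add: m_def d_def)
      moreover have "H i j * h l \<le> H i l * h j \<or> H i j * h l \<le> H j l * h i"
        using three[OF V] by (simp add: h_def le_max_iff_disj)
      ultimately have "m i j \<le> m i l \<or> m i j \<le> m l j"
        using \<open>0 \<le> d\<close> by (auto intro: mult_left_mono)
      then show ?thesis using True by (auto simp: k_def)
    next
      case False
      then have "min (k i l) (k l j) \<le> 0" by (auto simp: k_def)
      then show ?thesis using k0[OF V(1,2)] by simp
    qed
  qed (auto simp: k0, auto simp: k_def m_def sym mult.commute)
  then have "psd V (\<lambda>i j. h i * h j * k i j)" by (rule psd_congruence)
  moreover have "h i * h j * k i j = h i * h j - H z z * H i j" if "i \<in> V" "j \<in> V" for i j
    using H0[OF that] h that by (auto simp: k_def m_def right_diff_distrib order_less_le)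
  ultimately show "psd V (\<lambda>i j. h i * h j - H z z * H i j)"
    by (simp add: psd_def bform_def)
qed

section \<open>Sums over words and hyperbolicity of all Hessians\<close>

text \<open>Letters are appended in order and with repetition, like iterated derivatives along the
  all-ones direction; contraction is then a mere \<open>add_mset\<close>.\<close>

primrec extsum :: "('v multiset \<Rightarrow> real) \<Rightarrow> 'v set \<Rightarrow> nat \<Rightarrow> 'v multiset \<Rightarrow> real" where
  "extsum p V 0 m = p m"
| "extsum p V (Suc d) m = (\<Sum>i\<in>V. extsum p V d (add_mset i m))"

text \<open>Every axiom ranges over all m, so the assumptions persist under contraction.
  \<open>three_term\<close> feeds the bottom Hessians, while \<open>null\<close> and
  \<open>pos\<close> connect the nonzero rows through \<open>z\<close>.\<close>

locale exchange_weight =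
  fixes p :: "'v multiset \<Rightarrow> real" and V :: "'v set" and z :: 'v
  assumes fin: "finite V" and z: "z \<in> V"
    and nonneg: "0 \<le> p m"
    and null: "i \<in> V \<Longrightarrow> p m = 0 \<Longrightarrow> p (add_mset i m) = 0"
    and pos: "0 < p m \<Longrightarrow> 0 < p (add_mset z m)"
    and three_term: "i \<in> V \<Longrightarrow> j \<in> V \<Longrightarrow> l \<in> V \<Longrightarrow>
      p (add_mset i (add_mset j m)) * p (add_mset l (add_mset z m))
      \<le> max (p (add_mset i (add_mset l m)) * p (add_mset j (add_mset z m)))
          (p (add_mset j (add_mset l m)) * p (add_mset i (add_mset z m)))"
begin

definition hess :: "nat \<Rightarrow> 'v multiset \<Rightarrow> 'v \<Rightarrow> 'v \<Rightarrow> real" where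
  "hess d m i j = extsum p V d (add_mset i (add_mset j m))"

lemma hess_sym: "hess d m i j = hess d m j i"
  by (simp add: hess_def add_mset_commute)

lemma extsum_nonneg: "0 \<le> extsum p V d m"
  by (induction d arbitrary: m) (simp_all add: nonneg sum_nonneg)

lemma extsum_null: "p m = 0 \<Longrightarrow> extsum p V d m = 0"
  by (induction d arbitrary: m) (simp_all add: null)

lemma extsum_pos: "0 < p m \<Longrightarrow> 0 < extsum p V d m"
proof (induction d arbitrary: m)
  case (Suc d)
  then show ?case
    using fin z pos by (auto intro!: sum_pos2[of V z] extsum_nonneg)
qed simp

lemma hess_row_sum: "(\<Sum>j\<in>V. hess d m i j) = extsum p V (Suc d) (add_mset i m)"
  by (simp add: hess_def add_mset_commute)

lemma hess_total_sum: "(\<Sum>i\<in>V. \<Sum>j\<in>V. hess d m i j) = extsum p V (Suc (Suc d)) m"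
  unfolding hess_row_sum by simp

lemma hess_Suc: "hess (Suc d) m i j = (\<Sum>l\<in>V. hess d (add_mset l m) i j)"
  by (simp add: hess_def add_mset_commute)

text \<open>The Hessian of degree d + 1 is the sum over l of those of degree d contracted at l.
  Hyperbolicity of each summand, divided by its total sum and added up, is the Bochner
  inequality.\<close>

lemma hess_hyperbolic: "hyperbolic V (hess d m)"
proof (induction d arbitrary: m)
  case 0
  have H: "hess 0 m i j = p (add_mset i (add_mset j m))" for i j
    by (simp add: hess_def)
  show ?case
  proof (cases "p m = 0")
    case True
    then have "bform V (hess 0 m) u v = 0" for u v
      unfolding bform_def by (simp add: H null)
    then show ?thesis by (simp add: hyperbolic_def)
  next
    case False
    then have "0 < p m" using nonneg[of m] by simp
    show ?thesis
    proof (rule hyperbolic_if_three_term[OF fin z hess_sym])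
      show "0 < hess 0 m z z" using \<open>0 < p m\<close> by (simp add: H pos)
    qed (simp_all add: H nonneg three_term)
  qed
next
  case (Suc d)
  show ?case
  proof (rule hyperbolic_if_bochner[OF fin z hess_sym])
    show "0 \<le> hess (Suc d) m i j" for i j
      unfolding hess_def by (rule extsum_nonneg)
    show "0 < hess (Suc d) m i z" if ij: "i \<in> V" "j \<in> V" "0 < hess (Suc d) m i j" for i j
    proof -
      \<comment> \<open>\<open>null\<close> allows dropping j and \<open>pos\<close> allows adding
        \<open>z\<close>, so j can be traded for \<open>z\<close> inside the support.\<close>
      have "p (add_mset i (add_mset j m)) \<noteq> 0"
        using ij extsum_null unfolding hess_def by (metis less_irrefl)
      then have "p (add_mset i m) \<noteq> 0"
        using null[of j "add_mset i m"] ij by (auto simp: add_mset_commute)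
      then have "0 < p (add_mset i m)" using nonneg[of "add_mset i m"] by simp
      then have "0 < p (add_mset i (add_mset z m))" using pos by (subst add_mset_commute) auto
      then show ?thesis unfolding hess_def by (rule extsum_pos)
    qed
    fix v
    let ?row = "\<lambda>l. \<Sum>j\<in>V. hess (Suc d) m l j * v j"
    let ?D = "\<lambda>l. \<Sum>j\<in>V. hess (Suc d) m l j"
    have "bform V (hess (Suc d) m) v v
        = (\<Sum>i\<in>V. \<Sum>j\<in>V. \<Sum>l\<in>V. v i * (hess d (add_mset l m) i j * v j))"
      by (simp add: bform_def hess_Suc sum_distrib_left sum_distrib_right)
    also have "\<dots> = (\<Sum>i\<in>V. \<Sum>l\<in>V. \<Sum>j\<in>V. v i * (hess d (add_mset l m) i j * v j))"
      by (intro sum.cong refl sum.swap)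
    also have "\<dots> = (\<Sum>l\<in>V. \<Sum>i\<in>V. \<Sum>j\<in>V. v i * (hess d (add_mset l m) i j * v j))"
      by (rule sum.swap)
    also have "\<dots> = (\<Sum>l\<in>V. bform V (hess d (add_mset l m)) v v)"
      by (simp add: bform_def sum_distrib_left)
    also have "\<dots> \<le> (\<Sum>l\<in>V. (?row l)\<^sup>2 / ?D l)"
    proof (rule sum_mono)
      fix l assume l: "l \<in> V"
      let ?H = "hess d (add_mset l m)"
      \<comment> \<open>Euler's relation: the summed letter is absorbed into the degree, and the
        contracted letter l becomes a row index.\<close>
      have row: "(\<Sum>j\<in>V. ?H i j) = hess (Suc d) m l i" for i
        by (simp add: hess_def hess_row_sum add_mset_commute del: extsum.simps(2))
          (simp add: add_mset_commute)
      have "bform V ?H (\<lambda>_. 1) v = bform V ?H v (\<lambda>_. 1)"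
        by (rule bform_sym) (rule hess_sym)
      then have Hv: "bform V ?H (\<lambda>_. 1) v = ?row l"
        by (simp add: bform_def row mult.commute)
      have H1: "bform V ?H (\<lambda>_. 1) (\<lambda>_. 1) = ?D l"
        by (simp add: bform_def row)
      have ineq: "?D l * bform V ?H v v \<le> (?row l)\<^sup>2"
        using Suc.IH[of "add_mset l m"] unfolding hyperbolic_def Hv[symmetric] H1[symmetric] by blast
      have "0 \<le> ?D l" by (intro sum_nonneg) (simp add: hess_def extsum_nonneg del: extsum.simps)
      then consider "0 < ?D l" | "?D l = 0" by linarith
      then show "bform V ?H v v \<le> (?row l)\<^sup>2 / ?D l"
      proof cases
        case 1
        then show ?thesis using ineq by (simp add: field_simps)
      next
        \<comment> \<open>Nonnegative entries with total 0 all vanish, and the right side is 0 by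
          the convention x / 0 = 0.\<close>
        case 2
        have "hess (Suc d) m l i = 0" if "i \<in> V" for i
          using 2 that fin sum_nonneg_eq_0_iff[OF fin, of "hess (Suc d) m l"] extsum_nonneg
          unfolding hess_def by blast
        then have "(\<Sum>j\<in>V. ?H i j) = 0" if "i \<in> V" for i
          using that row by simp
        then have "?H i j = 0" if "i \<in> V" "j \<in> V" for i j
          using that fin sum_nonneg_eq_0_iff[OF fin, of "?H i"] extsum_nonneg
          unfolding hess_def by blast
        then show ?thesis using 2 by (simp add: bform_def)
      qed
    qed
    finally show "bform V (hess (Suc d) m) v v \<le> (\<Sum>l\<in>V. (?row l)\<^sup>2 / ?D l)" .
  qed
qed

text \<open>Hyperbolicity at the unit vector of \<open>z\<close>: the three pairings of it and the
  all-ones vector contract \<open>z\<close> not at all, once and twice.\<close>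

lemma extsum_log_concave:
  "extsum p V (Suc (Suc d)) m * extsum p V d (add_mset z (add_mset z m))
   \<le> (extsum p V (Suc d) (add_mset z m))\<^sup>2"
proof -
  define v where "v = (\<lambda>i. if i = z then 1 else (0::real))"
  have v: "(\<Sum>i\<in>V. g i * v i) = g z" for g
    using fin z by (simp add: v_def if_distrib cong: if_cong)
  have v': "(\<Sum>i\<in>V. v i * g i) = g z" for g
    using v[of g] by (simp add: mult.commute)
  have "bform V (hess d m) (\<lambda>_. 1) (\<lambda>_. 1) = extsum p V (Suc (Suc d)) m"
    by (simp add: bform_def hess_total_sum del: extsum.simps)
  moreover have "bform V (hess d m) v v = extsum p V d (add_mset z (add_mset z m))"
    by (simp add: bform_def v v' hess_def)
  moreover have "bform V (hess d m) (\<lambda>_. 1) v = extsum p V (Suc d) (add_mset z m)"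
    by (simp add: bform_def v hess_def)
  ultimately show ?thesis using hess_hyperbolic[of d m] unfolding hyperbolic_def by metis
qed

end

section \<open>Exchange inequality for maxima over bases\<close>

text \<open>The inserted 0 gives a value to sets that lie in no member of the family.\<close>

definition upper_max :: "'a set set \<Rightarrow> ('a set \<Rightarrow> real) \<Rightarrow> 'a set \<Rightarrow> real" where
  "upper_max \<B> \<mu> S = Max (insert 0 (\<mu> ` {B \<in> \<B>. S \<subseteq> B}))"

lemma upper_max_nonneg: "finite \<B> \<Longrightarrow> 0 \<le> upper_max \<B> \<mu> S"
  by (simp add: upper_max_def)

lemma upper_max_ge: "finite \<B> \<Longrightarrow> B \<in> \<B> \<Longrightarrow> S \<subseteq> B \<Longrightarrow> \<mu> B \<le> upper_max \<B> \<mu> S"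
  by (simp add: upper_max_def)

lemma upper_max_attained:
  assumes "finite \<B>" "upper_max \<B> \<mu> S \<noteq> 0"
  obtains B where "B \<in> \<B>" "S \<subseteq> B" "upper_max \<B> \<mu> S = \<mu> B"
proof -
  have "upper_max \<B> \<mu> S \<in> insert 0 (\<mu> ` {B \<in> \<B>. S \<subseteq> B})"
    unfolding upper_max_def using assms(1) by (intro Max_in) auto
  then show ?thesis using assms(2) that by blast
qed

lemma upper_max_antimono: "finite \<B> \<Longrightarrow> S \<subseteq> T \<Longrightarrow> upper_max \<B> \<mu> T \<le> upper_max \<B> \<mu> S"
  unfolding upper_max_def by (intro Max_mono) auto

text \<open>Take optimal \<open>S\<close> above A, a, b and \<open>T\<close> above A and C. If a
  lies in \<open>T\<close>, these two already witness the first product. Otherwise a is exchanged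
  for some t outside \<open>S\<close>, hence outside A; t outside C yields the first product, t in C
  the second. \<open>C\<close> may be empty so that the homogenising letter is covered as well as an
  element.\<close>

lemma upper_max_three_term:
  assumes fin: "finite \<B>"
    and nonneg: "\<And>B. B \<in> \<B> \<Longrightarrow> 0 \<le> \<mu> B"
    and exch: "\<And>S T s. S \<in> \<B> \<Longrightarrow> T \<in> \<B> \<Longrightarrow> s \<in> S - T \<Longrightarrow> \<exists>t\<in>T - S.
      S - {s} \<union> {t} \<in> \<B> \<and> T - {t} \<union> {s} \<in> \<B> \<and> \<mu> S * \<mu> T \<le> \<mu> (S - {s} \<union> {t}) * \<mu> (T - {t} \<union> {s})"
    and ab: "a \<noteq> b" and C: "C \<subseteq> {c}"
    and w: "w = upper_max \<B> \<mu>"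
  shows "w (insert a (insert b A)) * w (A \<union> C)
    \<le> max (w (insert a (A \<union> C)) * w (insert b A)) (w (insert b (A \<union> C)) * w (insert a A))"
proof (cases "w (insert a (insert b A)) = 0 \<or> w (A \<union> C) = 0")
  case True
  then show ?thesis using upper_max_nonneg[OF fin, of \<mu>] unfolding w by (auto simp: le_max_iff_disj)
next
  case False
  obtain S where S: "S \<in> \<B>" "insert a (insert b A) \<subseteq> S" "w (insert a (insert b A)) = \<mu> S"
    using False upper_max_attained[OF fin] unfolding w by metis
  obtain T where T: "T \<in> \<B>" "A \<union> C \<subseteq> T" "w (A \<union> C) = \<mu> T"
    using False upper_max_attained[OF fin] unfolding w by metis
  have bound: "\<mu> X * \<mu> Y \<le> w P * w Q" if "X \<in> \<B>" "Y \<in> \<B>" "P \<subseteq> X" "Q \<subseteq> Y" for X Y P Q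
    unfolding w using that fin nonneg
    by (intro mult_mono upper_max_ge) (auto intro: upper_max_nonneg)
  show ?thesis
  proof (cases "a \<in> T")
    case True
    have "\<mu> T * \<mu> S \<le> w (insert a (A \<union> C)) * w (insert b A)"
      using S T True by (intro bound) auto
    then show ?thesis using S T by (simp add: mult.commute le_max_iff_disj)
  next
    case False
    then obtain t where t: "t \<in> T - S" "S - {a} \<union> {t} \<in> \<B>" "T - {t} \<union> {a} \<in> \<B>"
      and le: "\<mu> S * \<mu> T \<le> \<mu> (S - {a} \<union> {t}) * \<mu> (T - {t} \<union> {a})"
      using exch[of S T a] S T by auto
    have aA: "a \<notin> A" using False T by auto
    show ?thesis
    proof (cases "t \<in> C")
      case True
      then have "C = {t}" using C by auto
      have "\<mu> (S - {a} \<union> {t}) * \<mu> (T - {t} \<union> {a}) \<le> w (insert b (A \<union> C)) * w (insert a A)"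
        using S T t aA ab \<open>C = {t}\<close> by (intro bound) auto
      then show ?thesis using S T le by simp
    next
      case False
      have "\<mu> (T - {t} \<union> {a}) * \<mu> (S - {a} \<union> {t}) \<le> w (insert a (A \<union> C)) * w (insert b A)"
        using S T t aA ab False by (intro bound) auto
      then show ?thesis using S T le by (simp add: mult.commute)
    qed
  qed
qed

section \<open>The homogenised weight\<close>

definition sqf :: "'a option multiset \<Rightarrow> bool" where
  "sqf m \<longleftrightarrow> (\<forall>a. count m (Some a) \<le> 1)"

definition supp :: "'a option multiset \<Rightarrow> 'a set" where
  "supp m = {a. Some a \<in># m}"

text \<open>The derivative at the origin, along the letters of m, of exp (t x) times the generating
  polynomial of \<open>w\<close>, with x the variable of \<open>None\<close>. That polynomial is
  multi-affine, so a repeated element gives 0, while each \<open>None\<close> costs a factor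
  t.\<close>

definition homog_weight :: "('a set \<Rightarrow> real) \<Rightarrow> real \<Rightarrow> 'a option multiset \<Rightarrow> real" where
  "homog_weight w t m = (if sqf m then t ^ count m None * w (supp m) else 0)"

lemma sqf_simps [simp]:
  "sqf {#}"
  "sqf (add_mset None m) \<longleftrightarrow> sqf m"
  "sqf (add_mset (Some a) m) \<longleftrightarrow> sqf m \<and> a \<notin> supp m"
proof -
  have "count (add_mset (Some a) m) (Some b) \<le> 1
      \<longleftrightarrow> count m (Some b) \<le> 1 \<and> (b = a \<longrightarrow> count m (Some a) = 0)" for b
    by auto
  then show "sqf (add_mset (Some a) m) \<longleftrightarrow> sqf m \<and> a \<notin> supp m"
    unfolding sqf_def supp_def by (auto simp: count_eq_zero_iff)
qed (simp_all add: sqf_def)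

lemma supp_simps [simp]:
  "supp {#} = {}"
  "supp (add_mset None m) = supp m"
  "supp (add_mset (Some a) m) = insert a (supp m)"
  by (auto simp: supp_def)

text \<open>All three products in \<open>three_term\<close> carry the same power of t, so the
  exchange inequality for \<open>w\<close> transfers.\<close>

lemma exchange_weight_homog_weight:
  assumes fin: "finite E" and t: "0 < t"
    and nonneg: "\<And>S. 0 \<le> w S"
    and antimono: "\<And>S T. S \<subseteq> T \<Longrightarrow> w T \<le> w S"
    and three: "\<And>a b c C A. a \<noteq> b \<Longrightarrow> C \<subseteq> {c} \<Longrightarrow> w (insert a (insert b A)) * w (A \<union> C)
      \<le> max (w (insert a (A \<union> C)) * w (insert b A)) (w (insert b (A \<union> C)) * w (insert a A))"
  shows "exchange_weight (homog_weight w t) (insert None (Some ` E)) None"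
proof
  let ?p = "homog_weight w t"
  show "0 \<le> ?p m" for m
    using t nonneg by (simp add: homog_weight_def)
  show "0 < ?p m \<Longrightarrow> 0 < ?p (add_mset None m)" for m
    using t by (auto simp: homog_weight_def zero_less_mult_iff split: if_splits)
  show "?p (add_mset i m) = 0" if "?p m = 0" for i m
  proof (cases i)
    case (Some a)
    have "w (supp m) = 0 \<Longrightarrow> w (insert a (supp m)) = 0"
      using nonneg[of "insert a (supp m)"] antimono[of "supp m" "insert a (supp m)"] by auto
    then show ?thesis using that t Some by (auto simp: homog_weight_def split: if_splits)
  qed (use that t in \<open>auto simp: homog_weight_def split: if_splits\<close>)
  fix i j l m
  let ?L = "?p (add_mset i (add_mset j m)) * ?p (add_mset l (add_mset None m))"
  let ?R1 = "?p (add_mset i (add_mset l m)) * ?p (add_mset j (add_mset None m))"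
  let ?R2 = "?p (add_mset j (add_mset l m)) * ?p (add_mset i (add_mset None m))"
  have R: "0 \<le> ?R1" "0 \<le> ?R2" using t nonneg by (simp_all add: homog_weight_def)
  show "?L \<le> max ?R1 ?R2"
  \<comment> \<open>If \<open>i\<close> or \<open>j\<close> is \<open>None\<close>, or
    \<open>l\<close> repeats one of them, the left product equals one of the right ones.\<close>
  proof (cases "i = None \<or> j = None \<or> l = i \<or> l = j \<or> ?L = 0")
    case True
    then show ?thesis
      using R by (elim disjE) (auto simp: add_mset_commute mult.commute le_max_iff_disj)
  next
    case False
    then obtain a b where ij: "i = Some a" "j = Some b" by auto
    have "?p (add_mset i (add_mset j m)) \<noteq> 0" "?p (add_mset l (add_mset None m)) \<noteq> 0"
      using False by auto
    then have sqf: "sqf (add_mset i (add_mset j m))" "sqf (add_mset l (add_mset None m))"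
      by (metis homog_weight_def)+
    then have ab: "a \<noteq> b" "a \<notin> supp m" "b \<notin> supp m" "sqf m" by (auto simp: ij)
    define u where "u = t ^ count m None"
    have u: "0 < u * u * t" "0 < u * u * t * t" using t by (simp_all add: u_def)
    show ?thesis
    proof (cases l)
      case None
      have "w (insert a (insert b (supp m))) * w (supp m)
          \<le> w (insert a (supp m)) * w (insert b (supp m))"
        using three[OF ab(1) empty_subsetI, of "supp m"] by (simp add: mult.commute)
      then have "(u * u * t * t) * (w (insert a (insert b (supp m))) * w (supp m))
          \<le> (u * u * t * t) * (w (insert a (supp m)) * w (insert b (supp m)))"
        using u by (simp only: mult_le_cancel_left_pos)
      then have "?L \<le> ?R1"
        using ab by (simp add: homog_weight_def ij None u_def algebra_simps)
      then show ?thesis by simp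
    next
      case (Some c)
      then have c: "c \<noteq> a" "c \<noteq> b" "c \<notin> supp m" using False sqf ij by auto
      let ?A = "supp m"
      have "w (insert a (insert b ?A)) * w (insert c ?A)
          \<le> w (insert a (insert c ?A)) * w (insert b ?A) \<or>
        w (insert a (insert b ?A)) * w (insert c ?A)
          \<le> w (insert b (insert c ?A)) * w (insert a ?A)"
        using three[OF ab(1) subset_refl, of ?A c] by (simp add: le_max_iff_disj)
      then have "(u * u * t) * (w (insert a (insert b ?A)) * w (insert c ?A))
          \<le> (u * u * t) * (w (insert a (insert c ?A)) * w (insert b ?A)) \<or>
        (u * u * t) * (w (insert a (insert b ?A)) * w (insert c ?A))
          \<le> (u * u * t) * (w (insert b (insert c ?A)) * w (insert a ?A))"
        using u by (simp only: mult_le_cancel_left_pos)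
      then have "?L \<le> ?R1 \<or> ?L \<le> ?R2"
        using ab c by (simp add: homog_weight_def ij Some u_def algebra_simps)
      then show ?thesis by (simp add: le_max_iff_disj)
    qed
  qed
qed (use fin in auto)

text \<open>The exponential factor reproduces itself under differentiation. Log-concavity thereby
  acquires t^2 on both sides, which cancels before the limit is taken.\<close>

lemma extsum_homog_weight_None:
  "extsum (homog_weight w t) V d (add_mset None m) = t * extsum (homog_weight w t) V d m"
proof (induction d arbitrary: m)
  case (Suc d)
  then show ?case by (simp add: add_mset_commute[of _ None] sum_distrib_left)
qed (simp add: homog_weight_def)

lemma extsum_homog_weight_not_sqf:
  "\<not> sqf m \<Longrightarrow> extsum (homog_weight w t) V d m = 0"
proof (induction d arbitrary: m)
  case (Suc d)
  have "\<not> sqf (add_mset i m)" for i using Suc.prems by (cases i) auto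
  then show ?case using Suc.IH by simp
qed (simp add: homog_weight_def)

lemma extsum_homog_weight_isCont: "isCont (\<lambda>t. extsum (homog_weight w t) V d m) x"
proof (induction d arbitrary: m)
  case 0
  then show ?case by (cases "sqf m") (simp_all add: homog_weight_def)
qed simp

text \<open>At \<open>t = 0\<close> only words without \<^term>\<open>None\<close> survive, and each set is reached through the
  \<^term>\<open>fact d\<close> orderings of the elements added to \<^term>\<open>supp m\<close>.\<close>

lemma extsum_homog_weight_0:
  assumes fin: "finite E"
  shows "sqf m \<Longrightarrow> None \<notin># m \<Longrightarrow> supp m \<subseteq> E \<Longrightarrow>
    extsum (homog_weight w 0) (insert None (Some ` E)) d m
    = fact d * (\<Sum>S | S \<subseteq> E \<and> supp m \<subseteq> S \<and> card S = card (supp m) + d. w S)"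
proof (induction d arbitrary: m)
  case 0
  have "S = supp m" if "S \<subseteq> E" "supp m \<subseteq> S" "card S = card (supp m)" for S
    using that card_subset_eq[of S "supp m"] finite_subset[OF _ fin, of S] by simp
  then have "{S. S \<subseteq> E \<and> supp m \<subseteq> S \<and> card S = card (supp m) + 0} = {supp m}"
    using 0 by auto
  \<comment> \<open>\<open>None\<close> is absent from m, so the power of t is 0 ^ 0 = 1.\<close>
  then show ?case using 0 by (simp add: homog_weight_def not_in_iff)
next
  case (Suc d)
  let ?A = "supp m"
  let ?\<S> = "{S. S \<subseteq> E \<and> ?A \<subseteq> S \<and> card S = card ?A + Suc d}"
  have finA: "finite ?A" using Suc.prems fin finite_subset by blast
  have finS: "finite ?\<S>" using fin by simp
  let ?f = "\<lambda>m. extsum (homog_weight w 0) (insert None (Some ` E)) d m"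
  have "extsum (homog_weight w 0) (insert None (Some ` E)) (Suc d) m
      = ?f (add_mset None m) + (\<Sum>a\<in>E. ?f (add_mset (Some a) m))"
    using fin by (simp add: sum.insert_if image_iff sum.reindex)
  also have "\<dots> = (\<Sum>a\<in>E. ?f (add_mset (Some a) m))"
    by (simp add: extsum_homog_weight_None)
  also have "\<dots> = (\<Sum>a\<in>E - ?A. ?f (add_mset (Some a) m))"
    using fin by (intro sum.mono_neutral_right) (auto simp: extsum_homog_weight_not_sqf)
  also have "\<dots> = (\<Sum>a\<in>E - ?A. fact d * (\<Sum>S | S \<in> ?\<S> \<and> a \<in> S. w S))"
  proof (intro sum.cong refl)
    fix a assume a: "a \<in> E - ?A"
    have "?f (add_mset (Some a) m)
        = fact d * (\<Sum>S | S \<subseteq> E \<and> insert a ?A \<subseteq> S \<and> card S = card (insert a ?A) + d. w S)"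
      using Suc.IH[of "add_mset (Some a) m"] a Suc.prems by simp
    also have "{S. S \<subseteq> E \<and> insert a ?A \<subseteq> S \<and> card S = card (insert a ?A) + d} = {S. S \<in> ?\<S> \<and> a \<in> S}"
      using a finA by auto
    finally show "?f (add_mset (Some a) m) = fact d * (\<Sum>S | S \<in> ?\<S> \<and> a \<in> S. w S)" .
  qed
  also have "\<dots> = fact d * (\<Sum>S\<in>?\<S>. \<Sum>a | a \<in> E - ?A \<and> a \<in> S. w S)"
    unfolding sum_distrib_left[symmetric]
    using fin by (subst sum.swap_restrict[OF _ finS]) simp_all
  \<comment> \<open>Each S is reached through d + 1 choices of the letter appended first; this turns
    \<open>fact d\<close> into \<open>fact (Suc d)\<close>.\<close>
  also have "(\<Sum>S\<in>?\<S>. \<Sum>a | a \<in> E - ?A \<and> a \<in> S. w S) = (\<Sum>S\<in>?\<S>. real (Suc d) * w S)"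
  proof (intro sum.cong refl)
    fix S assume S: "S \<in> ?\<S>"
    have "{a. a \<in> E - ?A \<and> a \<in> S} = S - ?A" using S by auto
    moreover have "card (S - ?A) = Suc d" using S finA by (simp add: card_Diff_subset)
    ultimately show "(\<Sum>a | a \<in> E - ?A \<and> a \<in> S. w S) = real (Suc d) * w S" by simp
  qed
  finally show ?case by (simp add: sum_distrib_left mult.assoc mult.left_commute)
qed

section \<open>Powers of q and the inequality for the level sums\<close>

text \<open>The value -\<infinity> is excluded because \<open>real_of_ereal\<close> sends it to 0,
  so that \<open>qpow\<close> is 1 there.\<close>

lemma qpow_antimono:
  assumes "0 < q" "q \<le> 1" "u \<noteq> -\<infinity>" "u \<le> v"
  shows "qpow q v \<le> qpow q u"
  using assms by (cases u; cases v) (auto simp: qpow_def intro: powr_mono')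

lemma qpow_add:
  assumes "0 < q" "u \<noteq> -\<infinity>" "v \<noteq> -\<infinity>"
  shows "qpow q (u + v) = qpow q u * qpow q v"
  using assms by (cases u; cases v) (auto simp: qpow_def powr_add)

lemma qpow_nonneg: "0 \<le> qpow q v"
  by (simp add: qpow_def)

text \<open>Powers of q are antitone, so the minimum becomes a maximum. The size bounds make the
  family under \<open>Min\<close> nonempty, and the 0 inserted in \<open>upper_max\<close> is
  harmless among nonnegative values.\<close>

lemma qpow_nu_ext:
  assumes fin: "finite E" and q: "0 < q" "q \<le> 1"
    and \<nu>: "\<And>B. B \<in> subsets_card E r \<Longrightarrow> \<nu> B \<noteq> -\<infinity>"
    and S: "S \<subseteq> E" "card S \<le> r" and r: "r \<le> card E"
  shows "qpow q (nu_ext E r \<nu> S) = upper_max (subsets_card E r) (\<lambda>B. qpow q (\<nu> B)) S"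
proof -
  let ?X = "{B \<in> subsets_card E r. S \<subseteq> B}"
  have finX: "finite ?X" using fin by (simp add: subsets_card_def)
  have "?X \<noteq> {}"
    using exists_subset_between[OF S(2) r S(1) fin] by (auto simp: subsets_card_def)
  then have "nu_ext E r \<nu> S \<in> \<nu> ` ?X"
    unfolding nu_ext_def using finX by (intro Min_in) auto
  then obtain B where B: "B \<in> ?X" "nu_ext E r \<nu> S = \<nu> B" by auto
  have "\<nu> B \<le> \<nu> B'" if "B' \<in> ?X" for B'
    using finX that B(2) by (simp add: nu_ext_def flip: B(2))
  then have "qpow q (\<nu> B') \<le> qpow q (\<nu> B)" if "B' \<in> ?X" for B'
    using q \<nu> B(1) that by (intro qpow_antimono) auto
  then show ?thesis
    unfolding upper_max_def B(2)
    using finX B(1) by (intro Max_eqI[symmetric]) (auto simp: qpow_nonneg)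
qed

theorem theoremA:
  fixes G :: "real set" and E :: "'a set" and r :: nat and \<nu> :: "'a set \<Rightarrow> ereal"
    and q :: real and k :: nat
  assumes "additive_subgroup_real G"
    and "valuated_matroid G E r \<nu>"
    and "0 < q" and "q \<le> 1"
    and "1 \<le> k" and "k < r"
  shows "(I_k q E r \<nu> k)\<^sup>2 \<ge>
           (real (k + 1) / real k) * I_k q E r \<nu> (k + 1) * I_k q E r \<nu> (k - 1)"
proof -
  let ?\<B> = "subsets_card E r" and ?V = "insert None (Some ` E)"
  define \<mu> where "\<mu> = (\<lambda>B. qpow q (\<nu> B))"
  define w where "w = upper_max ?\<B> \<mu>"
  have finE: "finite E"
    and ex: "\<exists>S\<in>?\<B>. \<nu> S \<noteq> \<infinity>"
    using assms(2) by (auto simp: valuated_matroid_def)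
  have \<nu>: "\<nu> B \<noteq> -\<infinity>" if "B \<in> ?\<B>" for B
    using assms(2) that by (auto simp: valuated_matroid_def valued_in_Gamma_bar_def)
  have finB: "finite ?\<B>" using finE by (simp add: subsets_card_def)
  have r: "r \<le> card E" using ex finE by (auto simp: subsets_card_def intro: card_mono)
  \<comment> \<open>Sums of valuations become products and the inequality reverses. The swapped sets
    may have value \<infinity>, whose power is 0.\<close>
  have exch: "\<exists>t\<in>T - S. S - {s} \<union> {t} \<in> ?\<B> \<and> T - {t} \<union> {s} \<in> ?\<B> \<and>
      \<mu> S * \<mu> T \<le> \<mu> (S - {s} \<union> {t}) * \<mu> (T - {t} \<union> {s})"
    if ST: "S \<in> ?\<B>" "T \<in> ?\<B>" and s: "s \<in> S - T" for S T s
  proof -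
    obtain t where t: "t \<in> T - S"
      and le: "\<nu> (S - {s} \<union> {t}) + \<nu> (T - {t} \<union> {s}) \<le> \<nu> S + \<nu> T"
      using assms(2) ST s unfolding valuated_matroid_def by blast
    have swap: "X - {x} \<union> {y} \<in> ?\<B>" if "X \<in> ?\<B>" "x \<in> X" "y \<in> E - X" for X x y
      using that finE finite_subset[of X E]
      by (auto simp: subsets_card_def card_insert_if card_Diff_singleton)
        (metis Suc_pred card_gt_0_iff empty_iff)
    have in_B: "S - {s} \<union> {t} \<in> ?\<B>" "T - {t} \<union> {s} \<in> ?\<B>"
      by (intro swap; use ST s t in \<open>auto simp: subsets_card_def\<close>)+
    have "qpow q (\<nu> S + \<nu> T) \<le> qpow q (\<nu> (S - {s} \<union> {t}) + \<nu> (T - {t} \<union> {s}))"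
      using assms(3,4) \<nu>[OF in_B(1)] \<nu>[OF in_B(2)] le by (intro qpow_antimono) auto
    then show ?thesis
      using t in_B ST assms(3) \<nu> by (auto simp: \<mu>_def qpow_add)
  qed
  have w_antimono: "w T \<le> w S" if "S \<subseteq> T" for S T
    unfolding w_def using finB that by (rule upper_max_antimono)
  have w_nonneg: "0 \<le> w S" for S
    unfolding w_def using finB by (rule upper_max_nonneg)
  have w_three: "w (insert a (insert b A)) * w (A \<union> C)
      \<le> max (w (insert a (A \<union> C)) * w (insert b A)) (w (insert b (A \<union> C)) * w (insert a A))"
    if "a \<noteq> b" "C \<subseteq> {c}" for a b c C A
    using finB _ exch that w_def by (rule upper_max_three_term) (simp add: \<mu>_def qpow_nonneg)
  have I: "extsum (homog_weight w 0) ?V j {#} = fact j * I_k q E r \<nu> j" if "j \<le> r" for j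
  proof -
    have "w S = qpow q (nu_ext E r \<nu> S)" if "S \<in> subsets_card E j" for S
      using qpow_nu_ext[OF finE assms(3,4), of r \<nu> S] \<nu> that r \<open>j \<le> r\<close>
      by (simp add: w_def \<mu>_def subsets_card_def)
    then show ?thesis
      using extsum_homog_weight_0[OF finE, of "{#}" w j]
      by (simp add: I_k_def subsets_card_def)
  qed
  obtain d where d: "k = Suc d" using assms(5) by (cases k) auto
  define f where "f = (\<lambda>j t. extsum (homog_weight w t) ?V j {#})"
  have "f (Suc (Suc d)) t * f d t \<le> (f (Suc d) t)\<^sup>2" if t: "0 < t" for t
  proof -
    interpret exchange_weight "homog_weight w t" ?V None
      using finE t w_nonneg w_antimono w_three by (rule exchange_weight_homog_weight)
    have "t\<^sup>2 * (f (Suc (Suc d)) t * f d t) \<le> t\<^sup>2 * (f (Suc d) t)\<^sup>2"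
      using extsum_log_concave[of d "{#}"]
      by (simp add: f_def extsum_homog_weight_None power_mult_distrib power2_eq_square
          algebra_simps del: extsum.simps)
    then show ?thesis using t by simp
  qed
  \<comment> \<open>The inequality is available for t > 0 only, hence the one-sided limit.\<close>
  then have ev: "\<forall>\<^sub>F t in at_right 0. f (Suc (Suc d)) t * f d t \<le> (f (Suc d) t)\<^sup>2"
    by (auto simp: eventually_at_filter)
  have "(f j \<longlongrightarrow> f j 0) (at_right 0)" for j
    using extsum_homog_weight_isCont[where w = w and V = ?V and d = j and m = "{#}" and x = 0] unfolding f_def isCont_def
    by (rule filterlim_at_split[THEN iffD1, THEN conjunct2])
  then have "f (Suc (Suc d)) 0 * f d 0 \<le> (f (Suc d) 0)\<^sup>2"
    using ev by (intro tendsto_le[OF _ _ _ ev] tendsto_intros) auto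
  then have "(fact (Suc k) * I_k q E r \<nu> (Suc k)) * (fact d * I_k q E r \<nu> d)
      \<le> (fact k * I_k q E r \<nu> k)\<^sup>2"
    using I[of "Suc k"] I[of k] I[of d] assms(6) by (simp add: f_def d del: extsum.simps)
  moreover have "(fact (Suc k) * x) * (fact d * y) = (fact k)\<^sup>2 * ((real (k + 1) / real k) * x * y)"
    for x y :: real
    by (simp add: d power2_eq_square field_simps)
  ultimately have "(fact k)\<^sup>2 * ((real (k + 1) / real k) * I_k q E r \<nu> (k + 1) * I_k q E r \<nu> (k - 1))
      \<le> (fact k)\<^sup>2 * (I_k q E r \<nu> k)\<^sup>2"
    by (simp add: power_mult_distrib d del: fact_Suc)
  then show ?thesis by (rule mult_left_le_imp_le) simp
qed

end
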